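(* Fix integers $a\ge 2$ and $k\ge 0$. For $n\ge 2$ let $X_{k,n}^{a}$ denote the number of nodes with exactly $k$ descendants in an $a$-recursive tree of order $n$, all these random variables being defined on a common probability space. Then $$\frac{X_{k,n}^{a}}{n} \longrightarrow \frac{1}{a^{k+1}} \sum_{s=1}^a s^k - \frac{1}{a^{k+2}} \sum_{s=1}^a s^{k+1} \qquad \text{almost surely, as } n \rightarrow \infty.$$
   Context: $a$-shuffle of $\{2,\dots,n\}$: start with the deck $2,3,\dots,n$ in increasing order; cut it into $a$ consecutive piles whose sizes $(b_1,\dots,b_a)$ (pile 1 consisting of the $b_1$ smallest cards, etc.) have the multinomial distribution with $n-1$ trials and probabilities $(1/a,\dots,1/a)$; then choose uniformly one of the $\binom{n-1}{b_1,\dots,b_a}$ ways of interleaving the piles keeping the cards of each pile in their original order. The resulting arrangement is $\gamma=(\gamma(2),\dots,\gamma(n))$, where $\gamma(j)$ is the card in position $j$. $a$-recursive tree ($a$-RT) of order $n$: the random rooted tree on vertices $1,\dots,n$ with root $1$, obtained by attaching each node $i\ge 2$ to the rightmost element $j$ of $\gamma$ which precedes $i$ and satisfies $j<i$; if there is no such $j$, the parent of $i$ is $1$. A descendant of a vertex $v$ is any vertex that is a child of $v$ or a descendant of a child of $v$ (so $v$ is not its own descendant). *)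

theory Defs
  imports "HOL-Probability.Probability" "HOL-Combinatorics.Multiset_Permutations"
begin

section \<open>The \<open>a\<close>-shuffle\<close>

text \<open>
  The multinomial distribution with \<open>N\<close> trials and probabilities \<open>(1/a, \<dots>, 1/a)\<close>: the list of the
  numbers of occurrences of each of the \<open>a\<close> outcomes \<open>0, \<dots>, a - 1\<close> in \<open>N\<close> independent uniform trials.
  The usual formula for its mass function is \<open>pmf_multinomial_pmf\<close> below.
\<close>

definition multinomial_pmf :: "nat \<Rightarrow> nat \<Rightarrow> nat list pmf" where
  "multinomial_pmf a N =
     map_pmf (\<lambda>xs. map (count_list xs) [0..<a]) (replicate_pmf N (pmf_of_set {..<a}))"

primrec cut :: "nat list \<Rightarrow> 'a list \<Rightarrow> 'a list list" where
  "cut [] xs = []"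
| "cut (b # bs) xs = take b xs # cut bs (drop b xs)"

text \<open>
  All ways of interleaving piles of pairwise distinct cards such that the cards of each pile keep
  their relative order.
\<close>

definition interleavings :: "'a list list \<Rightarrow> 'a list set" where
  "interleavings ps =
     {xs. mset xs = mset (concat ps) \<and> (\<forall>p\<in>set ps. filter (\<lambda>x. x \<in> set p) xs = p)}"

text \<open>
  The law of the arrangement obtained by an \<open>a\<close>-shuffle of the deck \<open>2, 3, \<dots>, n\<close>. The \<open>i\<close>-th element
  of the list (counted from \<open>0\<close>) is \<open>\<gamma>(i + 2)\<close>.
\<close>

definition shuffle_pmf :: "nat \<Rightarrow> nat \<Rightarrow> nat list pmf" where
  "shuffle_pmf a n = do {
     b \<leftarrow> multinomial_pmf a (n - 1);
     pmf_of_set (interleavings (cut b [2..<n + 1]))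
   }"

section \<open>\<open>a\<close>-recursive trees\<close>

definition parent :: "nat list \<Rightarrow> nat \<Rightarrow> nat" where
  "parent \<gamma> i =
     (let js = filter (\<lambda>j. j < i) (takeWhile (\<lambda>x. x \<noteq> i) \<gamma>) in if js = [] then 1 else last js)"

text \<open>
  Trees on the vertex set \<open>{1..n}\<close> with root \<open>1\<close> are represented by the set of their pairs
  (parent, child).
\<close>

definition tree_of :: "nat \<Rightarrow> nat list \<Rightarrow> (nat \<times> nat) set" where
  "tree_of n \<gamma> = {(parent \<gamma> i, i) | i. i \<in> {2..n}}"

definition recursive_tree_pmf :: "nat \<Rightarrow> nat \<Rightarrow> (nat \<times> nat) set pmf" where
  "recursive_tree_pmf a n = map_pmf (tree_of n) (shuffle_pmf a n)"

definition descendants :: "(nat \<times> nat) set \<Rightarrow> nat \<Rightarrow> nat set" where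
  "descendants T v = {w. (v, w) \<in> T\<^sup>+}"

definition num_nodes_with_descendants :: "nat \<Rightarrow> nat \<Rightarrow> (nat \<times> nat) set \<Rightarrow> nat" where
  "num_nodes_with_descendants k n T = card {v \<in> {1..n}. card (descendants T v) = k}"

section \<open>Well-definedness of the distributions\<close>

lemma pmf_replicate_pmf:
  "pmf (replicate_pmf N p) xs = (if length xs = N then prod_list (map (pmf p) xs) else 0)"
proof (induction N arbitrary: xs)
  case 0
  then show ?case by (auto simp: pmf_return)
next
  case (Suc N)
  have eq: "replicate_pmf (Suc N) p = map_pmf (\<lambda>(x, xs). x # xs) (pair_pmf p (replicate_pmf N p))"
    by (simp add: pair_pmf_def map_bind_pmf)
  show ?case
  proof (cases xs)
    case Nil
    have "[] \<notin> set_pmf (replicate_pmf (Suc N) p)" by (auto simp: eq)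
    with Nil show ?thesis by (simp add: set_pmf_iff del: replicate_pmf.simps)
  next
    case (Cons y ys)
    have "pmf (map_pmf (\<lambda>(x, xs). x # xs) (pair_pmf p (replicate_pmf N p))) ((\<lambda>(x, xs). x # xs) (y, ys))
            = pmf (pair_pmf p (replicate_pmf N p)) (y, ys)"
      by (intro pmf_map_inj') (auto simp: inj_on_def)
    with Cons show ?thesis by (simp add: eq pmf_pair Suc.IH del: replicate_pmf.simps)
  qed
qed

lemma pmf_multinomial_pmf:
  assumes "a > 0" "length b = a" "sum_list b = N"
  shows "pmf (multinomial_pmf a N) b = fact N / (\<Prod>i<a. fact (b ! i)) / real a ^ N"
proof -
  define B where "B = (\<Sum>i<a. replicate_mset (b ! i) i)"
  have count_B: "count B x = (if x < a then b ! x else 0)" for x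
    unfolding B_def by (auto simp: count_sum sum.delta)
  have size_B: "size B = N"
    using assms by (simp add: B_def size_multiset_sum sum_list_sum_nth atLeast0LessThan)
  have set_B: "set_mset B \<subseteq> {..<a}"
    by (auto simp: B_def set_mset_sum split: if_splits)
  let ?P = "replicate_pmf N (pmf_of_set {..<a})"
  have ne: "{..<a} \<noteq> {}" using assms(1) by (auto simp: lessThan_empty_iff)
  have supp: "set xs \<subseteq> {..<a}" if "xs \<in> set_pmf ?P" for xs
    using that by (auto simp: set_replicate_pmf set_pmf_of_set [OF ne])
  have "pmf (multinomial_pmf a N) b = measure ?P {xs. map (count_list xs) [0..<a] = b}"
    unfolding multinomial_pmf_def by (simp add: pmf_map vimage_def)
  also have "\<dots> = measure ?P (permutations_of_multiset B)"
  proof (rule measure_prob_cong_0)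
    fix xs assume xs: "xs \<in> {xs. map (count_list xs) [0..<a] = b} - permutations_of_multiset B"
    show "pmf ?P xs = 0"
    proof (rule ccontr)
      assume "pmf ?P xs \<noteq> 0"
      then have sub: "set xs \<subseteq> {..<a}" by (intro supp) (simp add: set_pmf_iff)
      have "mset xs = B"
      proof (rule multiset_eqI)
        fix x
        show "count (mset xs) x = count B x"
          using xs sub by (cases "x < a") (auto simp: count_B count_mset count_list_0_iff)
      qed
      with xs show False by (auto simp: permutations_of_multiset_def)
    qed
  next
    fix xs assume xs: "xs \<in> permutations_of_multiset B - {xs. map (count_list xs) [0..<a] = b}"
    then have "mset xs = B" by (auto simp: permutations_of_multiset_def)
    then have "map (count_list xs) [0..<a] = b"
      using assms(2) by (intro nth_equalityI) (auto simp: count_mset [symmetric] count_B)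
    with xs show "pmf ?P xs = 0" by auto
  qed
  also have "\<dots> = (\<Sum>xs\<in>permutations_of_multiset B. pmf ?P xs)"
    by (simp add: measure_measure_pmf_finite)
  also have "\<dots> = (\<Sum>xs\<in>permutations_of_multiset B. (1 / real a) ^ N)"
  proof (rule sum.cong [OF refl])
    fix xs assume "xs \<in> permutations_of_multiset B"
    then have m: "mset xs = B" by (auto simp: permutations_of_multiset_def)
    then have l: "length xs = N" using size_B size_mset by metis
    have "set xs \<subseteq> {..<a}" using set_B m set_mset_mset by metis
    then have "map (pmf (pmf_of_set {..<a})) xs = map (\<lambda>_. 1 / real a) xs"
      by (intro map_cong) (auto simp: indicator_def pmf_of_set [OF ne])
    then show "pmf ?P xs = (1 / real a) ^ N"
      by (simp add: pmf_replicate_pmf l map_replicate_const)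
  qed
  also have "\<dots> = real (card (permutations_of_multiset B)) / real a ^ N"
    by (simp add: power_divide)
  also have "real (card (permutations_of_multiset B)) = fact N / (\<Prod>i<a. fact (b ! i))"
  proof -
    have "(\<Prod>x\<in>set_mset B. fact (count B x)) = (\<Prod>i<a. fact (b ! i) :: nat)"
      using set_B by (intro prod.mono_neutral_cong_left) (auto simp: count_B not_in_iff)
    then have "card (permutations_of_multiset B) * (\<Prod>i<a. fact (b ! i)) = fact N"
      using card_permutations_of_multiset_aux [of B] size_B by simp
    then have "real (card (permutations_of_multiset B)) * (\<Prod>i<a. fact (b ! i)) = fact N"
      by (metis (mono_tags, lifting) of_nat_fact of_nat_mult of_nat_prod prod.cong)
    then show ?thesis by (simp add: field_simps)
  qed
  finally show ?thesis .
qed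

lemma concat_cut: "sum_list b = length xs \<Longrightarrow> concat (cut b xs) = xs"
  by (induction b arbitrary: xs) auto

lemma finite_interleavings: "finite (interleavings ps)"
  by (rule finite_subset [OF _ finite_permutations_of_multiset [of "mset (concat ps)"]])
     (auto simp: interleavings_def permutations_of_multiset_def)

lemma concat_in_interleavings: "distinct (concat ps) \<Longrightarrow> concat ps \<in> interleavings ps"
proof -
  assume d: "distinct (concat ps)"
  have "filter (\<lambda>x. x \<in> set p) (concat ps) = p" if "p \<in> set ps" for p
    using that d
  proof (induction ps)
    case (Cons q ps)
    show ?case
    proof (cases "p \<in> set ps")
      case True
      then have "set p \<inter> set q = {}" using Cons.prems by auto
      then have "filter (\<lambda>x. x \<in> set p) q = []" by (auto simp: filter_empty_conv)
      with Cons True show ?thesis by auto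
    next
      case False
      then have p: "p = q" using Cons.prems by auto
      then have "filter (\<lambda>x. x \<in> set p) (concat ps) = []"
        using Cons.prems by (auto simp: filter_empty_conv)
      with p show ?thesis by simp
    qed
  qed simp
  then show ?thesis by (auto simp: interleavings_def)
qed

end

theory Submission
  imports Defs
begin

text \<open>
  An \<open>a\<close>-shuffle is governed by a word of independent uniform letters: let \<open>w\<close> have one letter in
  \<open>{0, \<dots>, a - 1}\<close> for each position of the shuffled deck, naming the pile from which the card in that
  position comes. The letter counts of a uniform word are the multinomial pile sizes, and given these
  counts the word is uniform, which corresponds to a uniform interleaving of the piles
  (\<open>bij_betw_riffle\<close>, \<open>shuffle_pmf_eq\<close>).
  
  The tree depends only on the word. For positions \<open>s < t\<close>, the card at \<open>s\<close> is smaller than the card at \<open>t\<close>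
  if and only if \<open>w ! s \<le> w ! t\<close> (\<open>riffle_less_iff\<close>). The proper descendants of the card at position \<open>s\<close>
  are the cards in the longest run of positions directly after \<open>s\<close> in which all cards are larger
  (\<open>tree_of_trancl_iff\<close>). So, away from the end of the word, this card has exactly \<open>k\<close> descendants if and
  only if the \<open>k\<close> letters after \<open>w ! s\<close> are at least \<open>w ! s\<close> and the next one is smaller, which depends on
  a window of \<open>k + 2\<close> letters only (\<open>exact_run\<close>). With \<open>w ! s = x\<close>, such a window has probability
  \<open>(1/a) (\<Sum>x<a. ((a - x)/a)^k (x/a))\<close>, which is the claimed limit after the substitution \<open>s = a - x\<close>
  (\<open>run_prob_eq\<close>).
  
  The number of nodes with \<open>k\<close> descendants hence differs by \<open>O(k)\<close> from the number of windows of this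
  kind. Grouping the windows by their starting position modulo \<open>k + 2\<close> splits this number into \<open>k + 2\<close>
  counts over disjoint windows, each of which is binomially distributed (\<open>residue_count_pmf\<close>).
  Hoeffding's inequality then gives exponentially small deviation probabilities (\<open>tail_bound\<close>).
  These are summable in \<open>n\<close>, and the first Borel-Cantelli lemma, which needs no assumption on the joint
  law of the trees, yields almost sure convergence.
\<close>

section \<open>Riffling piles along a word of labels\<close>


text \<open>
  Interleaving piles along a word: each letter \<open>i\<close> of the word takes the next card of the \<open>i\<close>-th pile,
  piles being counted from \<open>0\<close>. It is only meant for words that never ask for a card of an exhausted
  pile.
\<close>

primrec riffle :: "'a list list \<Rightarrow> nat list \<Rightarrow> 'a list" where
  "riffle ps [] = []"
| "riffle ps (i # w) = hd (ps ! i) # riffle (ps[i := tl (ps ! i)]) w"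

text \<open>
  The words along which a list of piles is used up exactly.
\<close>

definition pile_words :: "'a list list \<Rightarrow> nat list set" where
  "pile_words ps =
     {w. set w \<subseteq> {..<length ps} \<and> (\<forall>i<length ps. count_list w i = length (ps ! i))}"

text \<open>
  The cards of \<open>xs\<close>, in order, whose position carries the letter \<open>i\<close> in the word \<open>w\<close>.
\<close>

definition labelled :: "nat \<Rightarrow> 'a list \<Rightarrow> nat list \<Rightarrow> 'a list" where
  "labelled i xs w = map fst (filter (\<lambda>z. snd z = i) (zip xs w))"

lemma labelled_Nil [simp]: "labelled i [] w = []" "labelled i xs [] = []"
  by (simp_all add: labelled_def)

lemma labelled_Cons [simp]:
  "labelled i (x # xs) (j # w) = (if j = i then x # labelled i xs w else labelled i xs w)"
  by (simp add: labelled_def)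

lemma length_riffle [simp]: "length (riffle ps w) = length w"
  by (induction w arbitrary: ps) auto

lemma pile_words_ConsD:
  assumes "i # w \<in> pile_words ps"
  shows "i < length ps" "ps ! i = hd (ps ! i) # tl (ps ! i)"
    "w \<in> pile_words (ps[i := tl (ps ! i)])"
proof -
  show i: "i < length ps" using assms by (auto simp: pile_words_def)
  have *: "length (ps ! j) = count_list w j + (if i = j then 1 else 0)" if "j < length ps" for j
    using assms that by (auto simp: pile_words_def)
  show "ps ! i = hd (ps ! i) # tl (ps ! i)"
    using *[OF i] by (cases "ps ! i") auto
  show "w \<in> pile_words (ps[i := tl (ps ! i)])"
    using assms * i by (auto simp: pile_words_def nth_list_update)
qed

lemma labelled_riffle:
  assumes "w \<in> pile_words ps" "i < length ps"
  shows "labelled i (riffle ps w) w = ps ! i"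
  using assms
proof (induction w arbitrary: ps)
  case Nil
  then show ?case by (auto simp: pile_words_def)
next
  case (Cons j w)
  note * = pile_words_ConsD[OF Cons.prems(1)]
  show ?case using Cons.IH[OF *(3)] Cons.prems(2) *(1,2)
    by (auto simp: nth_list_update)
qed

lemma riffle_unique:
  assumes "length xs = length w" "set w \<subseteq> {..<length ps}"
    "\<And>i. i < length ps \<Longrightarrow> labelled i xs w = ps ! i"
  shows "riffle ps w = xs"
  using assms
proof (induction w arbitrary: ps xs)
  case (Cons j w)
  obtain x xs' where xs: "xs = x # xs'" using Cons.prems(1) by (cases xs) auto
  have j: "j < length ps" using Cons.prems(2) by auto
  have hd: "ps ! j = x # labelled j xs' w" using Cons.prems(3)[OF j] by (simp add: xs)
  have "riffle (ps[j := tl (ps ! j)]) w = xs'"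
  proof (rule Cons.IH)
    fix i assume i: "i < length (ps[j := tl (ps ! j)])"
    then show "labelled i xs' w = ps[j := tl (ps ! j)] ! i"
      using Cons.prems(3)[of i] j by (cases "i = j") (simp_all add: xs hd)
  qed (use Cons.prems in \<open>simp_all add: xs\<close>)
  then show ?case by (simp add: xs hd)
qed simp

lemma mset_riffle:
  assumes "w \<in> pile_words ps"
  shows "mset (riffle ps w) = mset (concat ps)"
  using assms
proof (induction w arbitrary: ps)
  case Nil
  then have "p = []" if "p \<in> set ps" for p
    using that by (auto simp: pile_words_def in_set_conv_nth)
  then show ?case by (simp add: concat_eq_Nil_conv)
next
  case (Cons j w)
  note * = pile_words_ConsD[OF Cons.prems]
  have "mset (concat ps) = mset (concat (take j ps @ (hd (ps ! j) # tl (ps ! j)) # drop (Suc j) ps))"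
    using *(1,2) id_take_nth_drop by metis
  also have "\<dots> = add_mset (hd (ps ! j)) (mset (concat (ps[j := tl (ps ! j)])))"
    using *(1) by (simp add: upd_conv_take_nth_drop)
  finally show ?case using Cons.IH[OF *(3)] by simp
qed

lemma riffle_nth_in_pile:
  assumes "w \<in> pile_words ps" "t < length w"
  shows "riffle ps w ! t \<in> set (ps ! (w ! t))"
proof -
  have "w ! t < length ps" using assms by (auto simp: pile_words_def subset_iff)
  moreover have "(riffle ps w ! t, w ! t) \<in> set (zip (riffle ps w) w)"
    using assms(2) by (auto simp: in_set_zip)
  then have "riffle ps w ! t \<in> set (labelled (w ! t) (riffle ps w) w)"
    unfolding labelled_def by force
  ultimately show ?thesis using labelled_riffle[OF assms(1)] by simp
qed

lemma concat_split_nth: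
  "i < length ps \<Longrightarrow> concat ps = concat (take i ps) @ ps ! i @ concat (drop (Suc i) ps)"
  using id_take_nth_drop by (metis concat.simps(2) concat_append)

lemma pile_unique:
  assumes "distinct (concat ps)" "i < length ps" "j < length ps" "x \<in> set (ps ! i)" "x \<in> set (ps ! j)"
  shows "i = j"
proof (rule ccontr)
  have *: False if "i < j" "i < length ps" "j < length ps" "x \<in> set (ps ! i)" "x \<in> set (ps ! j)" for i j
  proof -
    have "ps ! i \<in> set (take j ps)" using that by (auto simp: in_set_conv_nth intro!: exI[of _ i])
    then show False using assms(1) that concat_split_nth[OF that(3)] by auto
  qed
  assume "i \<noteq> j"
  then show False using *[of i j] *[of j i] assms by (cases "i < j") auto
qed

lemma labelled_eq_filter:
  assumes "length xs = length w"
    "\<And>t. t < length w \<Longrightarrow> P (xs ! t) \<longleftrightarrow> w ! t = i"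
  shows "labelled i xs w = filter P xs"
  using assms
proof (induction xs w rule: list_induct2)
  case (Cons x xs y ys)
  have "P x \<longleftrightarrow> y = i" using Cons.prems[of 0] by simp
  moreover have "P (xs ! t) \<longleftrightarrow> ys ! t = i" if "t < length ys" for t
    using Cons.prems[of "Suc t"] that by simp
  ultimately show ?case using Cons.IH by simp
qed simp

lemma count_list_labelled:
  "length xs = length w \<Longrightarrow> count_list w i = length (labelled i xs w)"
  by (induction xs w rule: list_induct2) auto

text \<open>
  The inverse of riffling replaces each card by the index of its pile, which is well defined because the
  piles are disjoint.
\<close>

lemma bij_betw_riffle:
  assumes d: "distinct (concat ps)"
  shows "bij_betw (riffle ps) (pile_words ps) (interleavings ps)"
proof (rule bij_betwI')
  fix v w assume v: "v \<in> pile_words ps" and w: "w \<in> pile_words ps"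
  show "(riffle ps v = riffle ps w) = (v = w)"
  proof
    assume eq: "riffle ps v = riffle ps w"
    have len: "length v = length w" using eq by (metis length_riffle)
    show "v = w"
    proof (rule nth_equalityI[OF len])
      fix t assume t: "t < length v"
      show "v ! t = w ! t"
        using riffle_nth_in_pile[OF v t] riffle_nth_in_pile[OF w] t len eq v w
        by (intro pile_unique[OF d, of _ _ "riffle ps v ! t"])
           (auto simp: pile_words_def subset_iff)
    qed
  qed simp
next
  fix w assume w: "w \<in> pile_words ps"
  have "filter (\<lambda>x. x \<in> set (ps ! i)) (riffle ps w) = ps ! i" if i: "i < length ps" for i
  proof -
    have "labelled i (riffle ps w) w = filter (\<lambda>x. x \<in> set (ps ! i)) (riffle ps w)"
    proof (rule labelled_eq_filter)
      fix t assume t: "t < length w"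
      then have "w ! t < length ps" using w by (auto simp: pile_words_def subset_iff)
      then show "(riffle ps w ! t \<in> set (ps ! i)) = (w ! t = i)"
        using riffle_nth_in_pile[OF w t] pile_unique[OF d _ i] by blast
    qed simp
    then show ?thesis using labelled_riffle[OF w i] by simp
  qed
  then show "riffle ps w \<in> interleavings ps"
    using mset_riffle[OF w] by (auto simp: interleavings_def in_set_conv_nth)
next
  fix xs assume xs: "xs \<in> interleavings ps"
  have "\<exists>i<length ps. x \<in> set (ps ! i)" if "x \<in> set xs" for x
  proof -
    have "mset xs = mset (concat ps)" using xs by (simp add: interleavings_def)
    then have "x \<in> set (concat ps)" using that mset_eq_setD by blast
    then obtain p where "p \<in> set ps" "x \<in> set p" by auto
    then show ?thesis by (metis in_set_conv_nth)
  qed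
  then obtain l where l: "\<And>x. x \<in> set xs \<Longrightarrow> l x < length ps \<and> x \<in> set (ps ! l x)" by metis
  have lab: "labelled i xs (map l xs) = ps ! i" if i: "i < length ps" for i
  proof -
    have "labelled i xs (map l xs) = filter (\<lambda>x. x \<in> set (ps ! i)) xs"
    proof (rule labelled_eq_filter)
      fix t assume "t < length (map l xs)"
      then have "xs ! t \<in> set xs" "t < length xs" by auto
      then show "(xs ! t \<in> set (ps ! i)) = (map l xs ! t = i)"
        using l[of "xs ! t"] pile_unique[OF d _ i] by auto
    qed simp
    then show ?thesis using xs i by (simp add: interleavings_def)
  qed
  have "map l xs \<in> pile_words ps"
    using l lab count_list_labelled[of xs "map l xs"] by (auto simp: pile_words_def)
  moreover have "xs = riffle ps (map l xs)"
    using l lab by (intro riffle_unique[symmetric]) auto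
  ultimately show "\<exists>w\<in>pile_words ps. xs = riffle ps w" by blast
qed

lemma sorted_piles_less:
  assumes "sorted_wrt (<) (concat ps)" "i < j" "j < length ps" "x \<in> set (ps ! i)" "y \<in> set (ps ! j)"
  shows "x < y"
proof -
  have "ps ! i \<in> set (take j ps)" using assms by (auto simp: in_set_conv_nth intro!: exI[of _ i])
  then show ?thesis
    using assms(1,4,5) unfolding concat_split_nth[OF assms(3)] by (auto simp: sorted_wrt_append)
qed

text \<open>
  When the deck is cut in increasing order, a smaller letter means a smaller card, and cards with equal
  letters come from the same pile and keep their order. A tie therefore counts as an increase.
\<close>

lemma riffle_less_iff:
  fixes ps :: "'a :: linorder list list"
  assumes sorted: "sorted_wrt (<) (concat ps)" and w: "w \<in> pile_words ps"
    and "s < t" "t < length w"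
  shows "riffle ps w ! s < riffle ps w ! t \<longleftrightarrow> w ! s \<le> w ! t"
proof -
  let ?g = "riffle ps w"
  have s: "s < length w" using assms by simp
  have in_piles: "?g ! s \<in> set (ps ! (w ! s))" "?g ! t \<in> set (ps ! (w ! t))"
    using riffle_nth_in_pile[OF w] assms s by auto
  have bounds: "w ! s < length ps" "w ! t < length ps"
    using w assms s by (auto simp: pile_words_def subset_iff)
  consider "w ! s < w ! t" | "w ! t < w ! s" | "w ! s = w ! t" by linarith
  then show ?thesis
  proof cases
    case 1
    then show ?thesis using sorted_piles_less[OF sorted _ bounds(2) in_piles] by auto
  next
    case 2
    then show ?thesis using sorted_piles_less[OF sorted _ bounds(1) in_piles(2,1)] by auto
  next
    case 3
    let ?z = "zip ?g w" and ?P = "\<lambda>z. snd z = w ! t"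
    have split: "?z = take t ?z @ (?g ! t, w ! t) # drop (Suc t) ?z"
      using id_take_nth_drop[of t ?z] assms by simp
    have s_in: "(?g ! s, w ! s) \<in> set (take t ?z)"
      using assms by (auto simp: in_set_conv_nth intro!: exI[of _ s])
    have "sorted_wrt (<) (ps ! (w ! t))"
      using sorted unfolding concat_split_nth[OF bounds(2)] by (simp add: sorted_wrt_append)
    then have "sorted_wrt (<) (map fst (filter ?P ?z))"
      using labelled_riffle[OF w bounds(2)] by (simp add: labelled_def)
    then have "sorted_wrt (<) (map fst (filter ?P (take t ?z)) @ ?g ! t
                 # map fst (filter ?P (drop (Suc t) ?z)))"
      by (subst (asm) split) (simp del: take_zip drop_zip)
    moreover have "?g ! s \<in> set (map fst (filter ?P (take t ?z)))"
      using s_in 3 by force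
    ultimately have "?g ! s < ?g ! t" unfolding sorted_wrt_append by auto
    then show ?thesis using 3 by simp
  qed
qed

section \<open>The shuffle as a function of a uniform word\<close>

lemma length_cut [simp]: "length (cut b xs) = length b"
  by (induction b arbitrary: xs) auto

lemma length_cut_nth:
  "i < length b \<Longrightarrow> sum_list b \<le> length xs \<Longrightarrow> length (cut b xs ! i) = b ! i"
  by (induction b arbitrary: xs i) (auto simp: nth_Cons split: nat.splits)

text \<open>
  Words of length \<open>N\<close> over the alphabet \<open>{0, \<dots>, a - 1}\<close>.
\<close>

definition words :: "nat \<Rightarrow> nat \<Rightarrow> nat list set" where
  "words a N = {w. set w \<subseteq> {..<a} \<and> length w = N}"

text \<open>
  The sizes of the \<open>a\<close> piles, as determined by the word of pile indices.
\<close>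

definition pile_sizes :: "nat \<Rightarrow> nat list \<Rightarrow> nat list" where
  "pile_sizes a w = map (count_list w) [0..<a]"

text \<open>
  The arrangement of the deck \<open>2, \<dots>, n\<close> in which the card in each position comes from the pile named by
  the word \<open>w\<close>, which should have length \<open>n - 1\<close>.
\<close>

definition shuffled :: "nat \<Rightarrow> nat \<Rightarrow> nat list \<Rightarrow> nat list" where
  "shuffled a n w = riffle (cut (pile_sizes a w) [2..<n + 1]) w"

lemma sum_pile_sizes: "set w \<subseteq> {..<a} \<Longrightarrow> sum_list (pile_sizes a w) = length w"
  by (simp add: pile_sizes_def interv_sum_list_conv_sum_set_nat atLeast0LessThan sum_count_set)

lemma pile_words_cut:
  assumes "length b = a" "sum_list b = length xs"
  shows "pile_words (cut b xs) = {w \<in> words a (length xs). pile_sizes a w = b}"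
proof -
  have "w \<in> pile_words (cut b xs) \<longleftrightarrow> set w \<subseteq> {..<a} \<and> pile_sizes a w = b" for w
    using assms by (auto simp: pile_words_def length_cut_nth pile_sizes_def list_eq_iff_nth_eq)
  then show ?thesis
    unfolding words_def set_eq_iff mem_Collect_eq using assms(2) sum_pile_sizes by metis
qed

lemma finite_words: "finite (words a N)"
  unfolding words_def by (rule finite_lists_length_eq) simp

lemma words_nonempty: "a > 0 \<Longrightarrow> words a N \<noteq> {}"
  by (auto simp: words_def intro!: exI[of _ "replicate N 0"])

lemma card_words: "card (words a N) = a ^ N"
  unfolding words_def by (subst card_lists_length_eq) auto

lemma replicate_pmf_uniform:
  assumes "a > 0"
  shows "replicate_pmf N (pmf_of_set {..<a}) = pmf_of_set (words a N)"
proof (rule pmf_eqI)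
  fix w
  have ne: "{..<a} \<noteq> {}" using assms by (auto simp: lessThan_empty_iff)
  have "prod_list (map (pmf (pmf_of_set {..<a})) w) = (if set w \<subseteq> {..<a} then 1 / real a ^ length w else 0)"
    by (induction w) (auto simp: ne indicator_def)
  then show "pmf (replicate_pmf N (pmf_of_set {..<a})) w = pmf (pmf_of_set (words a N)) w"
    using assms
    by (simp add: pmf_replicate_pmf pmf_of_set finite_words words_nonempty card_words)
       (simp add: words_def indicator_def)
qed

lemma cond_pmf_of_set:
  assumes "finite A" "A \<inter> B \<noteq> {}"
  shows "cond_pmf (pmf_of_set A) B = pmf_of_set (A \<inter> B)"
proof (rule pmf_eqI)
  fix x
  have ne: "A \<noteq> {}" using assms by auto
  have "set_pmf (pmf_of_set A) \<inter> B \<noteq> {}" using assms ne by simp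
  from pmf_cond[OF this, of x] assms ne
  show "pmf (cond_pmf (pmf_of_set A) B) x = pmf (pmf_of_set (A \<inter> B)) x"
    by (auto simp: measure_pmf_of_set indicator_def)
qed

text \<open>
  Drawing the pile sizes first and then a uniform interleaving amounts to disintegrating the uniform
  distribution on words along the vector of letter counts.
\<close>

lemma shuffle_pmf_eq:
  assumes "a > 0"
  shows "shuffle_pmf a n = map_pmf (shuffled a n) (pmf_of_set (words a (n - 1)))"
proof -
  let ?W = "pmf_of_set (words a (n - 1))" and ?f = "pile_sizes a" and ?d = "[2..<n + 1]"
  have W: "set_pmf ?W = words a (n - 1)" using assms by (simp add: finite_words words_nonempty)
  have m: "multinomial_pmf a (n - 1) = map_pmf ?f ?W"
    unfolding multinomial_pmf_def replicate_pmf_uniform[OF assms] pile_sizes_def[abs_def] ..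
  have "?W = bind_pmf (map_pmf ?f ?W) (\<lambda>b. cond_pmf ?W {w. ?f w = b})"
  proof (rule bind_cond_pmf_cancel[symmetric])
    fix b w assume "?f w = b"
    then show "measure ?W {w. ?f w = b} = measure (map_pmf ?f ?W) {b. ?f w = b}"
      by (simp add: vimage_def eq_commute[of b])
  qed auto
  then have "map_pmf (shuffled a n) ?W =
      bind_pmf (map_pmf ?f ?W) (\<lambda>b. map_pmf (shuffled a n) (cond_pmf ?W {w. ?f w = b}))"
    by (metis map_bind_pmf)
  also have "\<dots> = bind_pmf (map_pmf ?f ?W) (\<lambda>b. pmf_of_set (interleavings (cut b ?d)))"
  proof (rule bind_pmf_cong[OF refl])
    fix b assume "b \<in> set_pmf (map_pmf ?f ?W)"
    then obtain w where w: "w \<in> words a (n - 1)" "?f w = b" unfolding set_map_pmf W by auto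
    have b: "length b = a" "sum_list b = length ?d"
      using w sum_pile_sizes[of w a] by (auto simp: pile_sizes_def words_def)
    have "length ?d = n - 1" by (simp del: upt_Suc)
    then have A: "words a (n - 1) \<inter> {w. ?f w = b} = pile_words (cut b ?d)"
      using pile_words_cut[OF b] by auto
    have "map_pmf (shuffled a n) (cond_pmf ?W {w. ?f w = b}) =
          map_pmf (riffle (cut b ?d)) (cond_pmf ?W {w. ?f w = b})"
    proof (rule map_pmf_cong[OF refl])
      have ne: "set_pmf ?W \<inter> {w. ?f w = b} \<noteq> {}" unfolding W using w by blast
      fix v assume "v \<in> set_pmf (cond_pmf ?W {w. ?f w = b})"
      then have "?f v = b" unfolding set_cond_pmf[OF ne] by blast
      then show "shuffled a n v = riffle (cut b ?d) v" by (simp only: shuffled_def)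
    qed
    also have "\<dots> = map_pmf (riffle (cut b ?d)) (pmf_of_set (pile_words (cut b ?d)))"
      unfolding A[symmetric] using w by (subst cond_pmf_of_set[OF finite_words]) blast+
    also have "\<dots> = pmf_of_set (interleavings (cut b ?d))"
    proof (rule map_pmf_of_set_bij_betw[OF bij_betw_riffle])
      show "distinct (concat (cut b ?d))" using b concat_cut by (metis distinct_upt)
      show "pile_words (cut b ?d) \<noteq> {}" using w A by auto
      show "finite (pile_words (cut b ?d))" unfolding A[symmetric] by (simp add: finite_words)
    qed
    finally show "map_pmf (shuffled a n) (cond_pmf ?W {w. ?f w = b}) =
                    pmf_of_set (interleavings (cut b ?d))" .
  qed
  finally show ?thesis by (simp only: shuffle_pmf_def m)
qed

lemma shuffled_props:
  assumes w: "w \<in> words a (n - 1)"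
  shows "length (shuffled a n w) = n - 1" "mset (shuffled a n w) = mset [2..<n + 1]"
    "\<And>s t. s < t \<Longrightarrow> t < n - 1 \<Longrightarrow> shuffled a n w ! s < shuffled a n w ! t \<longleftrightarrow> w ! s \<le> w ! t"
proof -
  let ?b = "pile_sizes a w" and ?d = "[2..<n + 1]"
  show "length (shuffled a n w) = n - 1" using w by (simp add: shuffled_def words_def)
  have b: "length ?b = a" "sum_list ?b = length ?d"
    using w sum_pile_sizes[of w a] by (auto simp: pile_sizes_def words_def)
  have c: "concat (cut ?b ?d) = ?d" using b(2) by (rule concat_cut)
  have len: "length ?d = n - 1" by (simp del: upt_Suc)
  have w': "w \<in> pile_words (cut ?b ?d)" using w pile_words_cut[OF b] unfolding len by blast
  show "mset (shuffled a n w) = mset ?d" using mset_riffle[OF w'] c by (simp add: shuffled_def)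
  show "shuffled a n w ! s < shuffled a n w ! t \<longleftrightarrow> w ! s \<le> w ! t" if "s < t" "t < n - 1" for s t
    using riffle_less_iff[OF _ w' that(1)] that w c
    by (simp add: shuffled_def words_def del: upt_Suc)
qed

section \<open>Descendants in the tree of an arrangement\<close>

lemma last_filter_eqI:
  assumes "s < length xs" "P (xs ! s)" "\<And>u. s < u \<Longrightarrow> u < length xs \<Longrightarrow> \<not> P (xs ! u)"
  shows "filter P xs \<noteq> []" "last (filter P xs) = xs ! s"
proof -
  have "filter P (drop (Suc s) xs) = []"
    using assms(3) by (auto simp: filter_empty_conv in_set_conv_nth)
  moreover have "xs = take s xs @ xs ! s # drop (Suc s) xs"
    using assms(1) by (rule id_take_nth_drop)
  ultimately have "filter P xs = filter P (take s xs) @ [xs ! s]"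
    using assms(2) by (metis filter.simps(2) filter_append)
  then show "filter P xs \<noteq> []" "last (filter P xs) = xs ! s" by simp_all
qed

text \<open>
  The parent of a card is the nearest smaller card to its left, and the root if there is none.
\<close>

lemma parent_nth:
  assumes "distinct \<gamma>" "t < length \<gamma>"
  shows "parent \<gamma> (\<gamma> ! t) = 1 \<and> (\<forall>u<t. \<not> \<gamma> ! u < \<gamma> ! t) \<or>
         (\<exists>s<t. parent \<gamma> (\<gamma> ! t) = \<gamma> ! s \<and> \<gamma> ! s < \<gamma> ! t \<and> (\<forall>u. s < u \<and> u < t \<longrightarrow> \<not> \<gamma> ! u < \<gamma> ! t))"
proof -
  have tw: "takeWhile (\<lambda>x. x \<noteq> \<gamma> ! t) \<gamma> = take t \<gamma>"
    using assms by (intro takeWhile_eq_take_P_nth) (auto simp: nth_eq_iff_index_eq)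
  show ?thesis
  proof (cases "\<exists>s<t. \<gamma> ! s < \<gamma> ! t")
    case False
    then have "filter (\<lambda>j. j < \<gamma> ! t) (take t \<gamma>) = []"
      by (auto simp: filter_empty_conv in_set_conv_nth)
    with False show ?thesis by (simp add: parent_def tw)
  next
    case True
    let ?S = "{s. s < t \<and> \<gamma> ! s < \<gamma> ! t}"
    define s where "s = Max ?S"
    have fin: "finite ?S" by simp
    have s: "s \<in> ?S" unfolding s_def using True by (intro Max_in fin) auto
    have max: "\<not> \<gamma> ! u < \<gamma> ! t" if "s < u" "u < t" for u
    proof
      assume "\<gamma> ! u < \<gamma> ! t"
      then have "u \<in> ?S" using that by simp
      then have "u \<le> s" unfolding s_def by (rule Max_ge[OF fin])
      with that show False by simp
    qed
    from last_filter_eqI[of s "take t \<gamma>" "\<lambda>j. j < \<gamma> ! t"]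
    have "parent \<gamma> (\<gamma> ! t) = \<gamma> ! s"
      using s max assms(2) by (simp add: parent_def tw)
    then show ?thesis using s max by blast
  qed
qed

text \<open>
  The descendants of a card are the larger cards that follow it without interruption by a smaller one.
\<close>

lemma tree_of_trancl_iff:
  assumes d: "distinct \<gamma>" and set: "set \<gamma> = {2..n}" and s: "s < length \<gamma>"
  shows "(\<gamma> ! s, y) \<in> (tree_of n \<gamma>)\<^sup>+ \<longleftrightarrow>
           (\<exists>t. s < t \<and> t < length \<gamma> \<and> y = \<gamma> ! t \<and> (\<forall>u\<in>{s<..t}. \<gamma> ! s < \<gamma> ! u))"
    (is "_ \<longleftrightarrow> (\<exists>t. ?R t y)")
proof -
  have ge2: "\<gamma> ! t \<noteq> 1" if "t < length \<gamma>" for t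
    using nth_mem[OF that] unfolding set by auto
  have edge: "s < t \<and> \<gamma> ! s < \<gamma> ! t \<and> (\<forall>u. s < u \<and> u < t \<longrightarrow> \<gamma> ! t < \<gamma> ! u)"
    if "s < length \<gamma>" "t < length \<gamma>" "\<gamma> ! s = parent \<gamma> (\<gamma> ! t)" for s t
  proof -
    from parent_nth[OF d that(2)] ge2[OF that(1)] that(3)
    obtain r where r: "r < t" "\<gamma> ! s = \<gamma> ! r" "\<gamma> ! r < \<gamma> ! t"
        "\<And>u. r < u \<Longrightarrow> u < t \<Longrightarrow> \<not> \<gamma> ! u < \<gamma> ! t"
      by auto
    have "r = s" using r(1,2) that d by (simp add: nth_eq_iff_index_eq)
    moreover have "\<gamma> ! u \<noteq> \<gamma> ! t" if "u < t" for u
      using that \<open>t < length \<gamma>\<close> d by (simp add: nth_eq_iff_index_eq)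
    ultimately show ?thesis using r by (metis linorder_neqE_nat)
  qed
  have edgeI: "(parent \<gamma> (\<gamma> ! t), \<gamma> ! t) \<in> tree_of n \<gamma>" if "t < length \<gamma>" for t
    using nth_mem[OF that] unfolding set tree_of_def by auto
  show ?thesis
  proof
    assume "(\<gamma> ! s, y) \<in> (tree_of n \<gamma>)\<^sup>+"
    then show "\<exists>t. ?R t y"
    proof (induction rule: trancl_induct)
      case (base y)
      then have y: "\<gamma> ! s = parent \<gamma> y" "y \<in> set \<gamma>" by (auto simp: tree_of_def set)
      then obtain t where t: "t < length \<gamma>" "y = \<gamma> ! t" by (auto simp: in_set_conv_nth)
      with edge[OF s t(1)] y(1) have "?R t y" by (auto simp: order.strict_iff_not intro: order.trans)
      then show ?case by blast
    next
      case (step x y)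
      then obtain r where r: "s < r" "r < length \<gamma>" "x = \<gamma> ! r" "\<forall>u\<in>{s<..r}. \<gamma> ! s < \<gamma> ! u"
        by blast
      have y: "\<gamma> ! r = parent \<gamma> y" "y \<in> set \<gamma>" using step.hyps(2) r(3) by (auto simp: tree_of_def set)
      then obtain t where t: "t < length \<gamma>" "y = \<gamma> ! t" by (auto simp: in_set_conv_nth)
      note e = edge[OF r(2) t(1) y(1)[unfolded t(2)]]
      have "\<gamma> ! s < \<gamma> ! u" if "s < u" "u \<le> t" for u
      proof (cases "u \<le> r")
        case True
        then show ?thesis using r that by auto
      next
        case False
        then have "\<gamma> ! r < \<gamma> ! u"
          using e that by (cases "u = t") (auto intro: order.strict_trans[of _ "\<gamma> ! t"])
        moreover have "\<gamma> ! s < \<gamma> ! r" using r by auto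
        ultimately show ?thesis by simp
      qed
      then have "?R t y" using t e r(1) by auto
      then show ?case by blast
    qed
  next
    have "(\<gamma> ! s, \<gamma> ! t) \<in> (tree_of n \<gamma>)\<^sup>+"
      if "s < t" "t < length \<gamma>" "\<forall>u\<in>{s<..t}. \<gamma> ! s < \<gamma> ! u" for t
      using that
    proof (induction t rule: less_induct)
      case (less t)
      have st: "\<gamma> ! s < \<gamma> ! t" using less.prems by auto
      then obtain r where r: "r < t" "parent \<gamma> (\<gamma> ! t) = \<gamma> ! r"
          "\<And>u. r < u \<Longrightarrow> u < t \<Longrightarrow> \<not> \<gamma> ! u < \<gamma> ! t"
        using parent_nth[OF d less.prems(2)] less.prems(1) by blast
      have sr: "s \<le> r" using r(3)[of s] st less.prems(1) by (meson not_less)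
      have e: "(\<gamma> ! r, \<gamma> ! t) \<in> tree_of n \<gamma>" using edgeI[OF less.prems(2)] r(2) by simp
      show ?case
      proof (cases "s = r")
        case True
        then show ?thesis using e by auto
      next
        case False
        have "(\<gamma> ! s, \<gamma> ! r) \<in> (tree_of n \<gamma>)\<^sup>+"
          using False sr r(1) less.prems by (intro less.IH) auto
        then show ?thesis using e by (rule trancl_into_trancl)
      qed
    qed
    then show "\<exists>t. ?R t y \<Longrightarrow> (\<gamma> ! s, y) \<in> (tree_of n \<gamma>)\<^sup>+" by blast
  qed
qed

text \<open>
  The first letter of \<open>w\<close> is a lower bound for exactly \<open>k\<close> letters following it before a smaller one
  occurs. Only the first \<open>k + 2\<close> letters matter, and \<open>w\<close> is meant to have at least that many.
\<close>

definition exact_run :: "nat \<Rightarrow> nat list \<Rightarrow> bool" where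
  "exact_run k w \<longleftrightarrow> (\<forall>u\<in>{1..k}. w ! 0 \<le> w ! u) \<and> w ! (k + 1) < w ! 0"

lemma card_run_eq_iff:
  fixes w :: "nat list"
  assumes "s + k + 1 < length w"
  shows "card {t. s < t \<and> t < length w \<and> (\<forall>u\<in>{s<..t}. w ! s \<le> w ! u)} = k \<longleftrightarrow>
         exact_run k (drop s w)" (is "card ?D = k \<longleftrightarrow> _")
proof -
  have run: "exact_run k (drop s w) \<longleftrightarrow>
      (\<forall>u\<in>{s<..s + k}. w ! s \<le> w ! u) \<and> w ! (s + k + 1) < w ! s"
  proof -
    have eq: "{s<..s + k} = (\<lambda>u. s + u) ` {1..k}" by (simp add: atLeastSucAtMost_greaterThanAtMost)
    have "(\<forall>u\<in>{s<..s + k}. w ! s \<le> w ! u) \<longleftrightarrow> (\<forall>u\<in>{1..k}. w ! s \<le> w ! (s + u))"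
      unfolding eq by blast
    then show ?thesis using assms by (simp add: exact_run_def)
  qed
  have fin: "finite ?D" by simp
  show ?thesis
  proof
    assume c: "card ?D = k"
    \<comment> \<open>\<open>?D\<close> is an interval starting directly after \<open>s\<close>, so its size determines it.\<close>
    have not: "s + k + 1 \<notin> ?D"
    proof
      assume "s + k + 1 \<in> ?D"
      then have "{s<..s + k + 1} \<subseteq> ?D" by auto
      then have "card {s<..s + k + 1} \<le> card ?D" by (intro card_mono fin)
      with c show False by simp
    qed
    have "?D \<subseteq> {s<..s + k}"
    proof
      fix t assume t: "t \<in> ?D"
      show "t \<in> {s<..s + k}"
      proof (rule ccontr)
        assume "t \<notin> {s<..s + k}"
        then have "s + k + 1 \<in> ?D" using t by auto
        with not show False by blast
      qed
    qed
    then have D: "?D = {s<..s + k}" using c by (intro card_subset_eq) auto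
    have run_le: "\<forall>u\<in>{s<..s + k}. w ! s \<le> w ! u"
    proof
      fix u assume "u \<in> {s<..s + k}"
      then have "u \<in> ?D" by (simp only: D)
      then show "w ! s \<le> w ! u" by simp
    qed
    have "w ! (s + k + 1) < w ! s"
    proof (rule ccontr)
      assume "\<not> w ! (s + k + 1) < w ! s"
      moreover have "{s<..s + k + 1} = insert (s + k + 1) {s<..s + k}" by auto
      ultimately have "\<forall>u\<in>{s<..s + k + 1}. w ! s \<le> w ! u" using run_le by simp
      with not assms show False by simp
    qed
    with run_le show "exact_run k (drop s w)" by (simp add: run)
  next
    assume "exact_run k (drop s w)"
    then have *: "\<forall>u\<in>{s<..s + k}. w ! s \<le> w ! u" "\<not> w ! s \<le> w ! (s + k + 1)" by (auto simp: run)
    have "t \<le> s + k" if "t \<in> ?D" for t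
    proof (rule ccontr)
      assume "\<not> t \<le> s + k"
      then have "s + k + 1 \<in> {s<..t}" by auto
      with that *(2) show False by blast
    qed
    then have "?D = {s<..s + k}" using * assms by auto
    then show "card ?D = k" by simp
  qed
qed

text \<open>
  The error term \<open>n - L\<close> accounts for the root and for the \<open>n - 1 - L\<close> cards in the positions from \<open>L\<close> on.
\<close>

lemma num_nodes_bounds:
  assumes n: "n \<ge> 1" and w: "w \<in> words a (n - 1)" and L: "L + k + 1 \<le> n - 1"
  defines "X \<equiv> num_nodes_with_descendants k n (tree_of n (shuffled a n w))"
    and "S \<equiv> card {s. s < L \<and> exact_run k (drop s w)}"
  shows "S \<le> X" "X \<le> S + (n - L)"
proof -
  define \<gamma> where "\<gamma> = shuffled a n w"
  note props = shuffled_props[OF w, folded \<gamma>_def]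
  have lw: "length w = n - 1" using w by (simp add: words_def)
  have set: "set \<gamma> = {2..n}" using mset_eq_setD[OF props(2)] by auto
  have d: "distinct \<gamma>" using props(2) by (metis distinct_upt mset_eq_imp_distinct_iff)
  let ?T = "tree_of n \<gamma>"
  let ?good = "\<lambda>s. card (descendants ?T (\<gamma> ! s)) = k"
  have good: "?good s \<longleftrightarrow> exact_run k (drop s w)" if "s < L" for s
  proof -
    let ?D = "{t. s < t \<and> t < length w \<and> (\<forall>u\<in>{s<..t}. w ! s \<le> w ! u)}"
    have "descendants ?T (\<gamma> ! s) = (!) \<gamma> ` {t. s < t \<and> t < length \<gamma> \<and> (\<forall>u\<in>{s<..t}. \<gamma> ! s < \<gamma> ! u)}"
      using tree_of_trancl_iff[OF d set, of s] that L props(1) by (auto simp: descendants_def)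
    also have "{t. s < t \<and> t < length \<gamma> \<and> (\<forall>u\<in>{s<..t}. \<gamma> ! s < \<gamma> ! u)} = ?D"
      using props(1,3) lw by (auto simp: Ball_def)
    finally have "card (descendants ?T (\<gamma> ! s)) = card ?D"
      using d lw props(1) by (simp add: card_image inj_on_def nth_eq_iff_index_eq)
    then show ?thesis using card_run_eq_iff[of s k w] that L lw by simp
  qed
  have inj: "inj_on ((!) \<gamma>) A" if "A \<subseteq> {..<n - 1}" for A
    using that d props(1) by (auto simp: inj_on_def nth_eq_iff_index_eq subset_iff)
  have S: "S = card ((!) \<gamma> ` {s. s < L \<and> ?good s})"
  proof -
    have "{s. s < L \<and> exact_run k (drop s w)} = {s. s < L \<and> ?good s}" using good by blast
    moreover have "{s. s < L \<and> ?good s} \<subseteq> {..<n - 1}" using L by auto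
    ultimately show ?thesis unfolding S_def using card_image[OF inj] by metis
  qed
  have X: "X = card {v \<in> {1..n}. card (descendants ?T v) = k}"
    by (simp add: X_def num_nodes_with_descendants_def \<gamma>_def)
  have range: "\<gamma> ! s \<in> {1..n}" if "s < n - 1" for s
    using nth_mem[of s \<gamma>] props(1) set that by auto
  show "S \<le> X" unfolding S X
  proof (rule card_mono)
    show "(!) \<gamma> ` {s. s < L \<and> ?good s} \<subseteq> {v \<in> {1..n}. card (descendants ?T v) = k}"
      using range L by auto
  qed simp
  have "{v \<in> {1..n}. card (descendants ?T v) = k} \<subseteq>
          (!) \<gamma> ` {s. s < L \<and> ?good s} \<union> insert 1 ((!) \<gamma> ` {L..<n - 1})"
  proof
    fix v assume v: "v \<in> {v \<in> {1..n}. card (descendants ?T v) = k}"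
    show "v \<in> (!) \<gamma> ` {s. s < L \<and> ?good s} \<union> insert 1 ((!) \<gamma> ` {L..<n - 1})"
    proof (cases "v = 1")
      case False
      then have "v \<in> set \<gamma>" using v by (auto simp: set)
      then obtain s where "s < n - 1" "v = \<gamma> ! s" using props(1) by (auto simp: in_set_conv_nth)
      then show ?thesis using v by (cases "s < L") auto
    qed simp
  qed
  then have "X \<le> card ((!) \<gamma> ` {s. s < L \<and> ?good s} \<union> insert 1 ((!) \<gamma> ` {L..<n - 1}))"
    unfolding X by (intro card_mono) auto
  also have "\<dots> \<le> S + card (insert 1 ((!) \<gamma> ` {L..<n - 1}))"
    unfolding S by (rule card_Un_le)
  also have "card (insert 1 ((!) \<gamma> ` {L..<n - 1})) \<le> Suc (card {L..<n - 1})"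
    using card_image_le[of "{L..<n - 1}" "(!) \<gamma>"] by (simp add: card_insert_if)
  also have "Suc (card {L..<n - 1}) = n - L" using L n by simp
  finally show "X \<le> S + (n - L)" by simp
qed

section \<open>The law of the number of runs\<close>

lemma exact_run_append: "length xs = k + 2 \<Longrightarrow> exact_run k (xs @ ys) = exact_run k xs"
  by (auto simp: exact_run_def nth_append)

text \<open>
  The probability that a uniform word of length \<open>k + 2\<close> satisfies \<open>exact_run k\<close> (shown in \<open>map_exact_run_pmf\<close>), written
  in the form of the limit to be proved.
\<close>

definition run_prob :: "nat \<Rightarrow> nat \<Rightarrow> real" where
  "run_prob a k = 1 / real a ^ (k + 1) * (\<Sum>s = 1..a. real s ^ k)
                - 1 / real a ^ (k + 2) * (\<Sum>s = 1..a. real s ^ (k + 1))"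

lemma card_exact_run:
  "card {w \<in> words a (k + 2). exact_run k w} = (\<Sum>x<a. (a - x) ^ k * x)"
proof -
  let ?M = "\<lambda>x. {ys. set ys \<subseteq> {x..<a} \<and> length ys = k}"
  let ?S = "SIGMA x:{..<a}. ?M x \<times> {..<x}"
  let ?f = "\<lambda>(x, ys, z). x # ys @ [z]"
  have "{w \<in> words a (k + 2). exact_run k w} = ?f ` ?S"
  proof (intro equalityI subsetI)
    fix w assume "w \<in> {w \<in> words a (k + 2). exact_run k w}"
    then have w: "set w \<subseteq> {..<a}" "length w = k + 2" "exact_run k w" by (auto simp: words_def)
    then obtain x v where v: "w = x # v" by (cases w) auto
    then obtain ys z where yz: "v = ys @ [z]" using w(2) by (cases v rule: rev_exhaust) auto
    have len: "length ys = k" using w(2) v yz by simp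
    have "x \<le> y" if "y \<in> set ys" for y
    proof -
      obtain i where i: "i < k" "y = ys ! i" using \<open>y \<in> set ys\<close> len by (auto simp: in_set_conv_nth)
      have "w ! 0 \<le> w ! (Suc i)" using w(3) i(1) by (auto simp: exact_run_def)
      then show ?thesis using i len v yz by (simp add: nth_append)
    qed
    moreover have "z < x" using w(3) len v yz by (auto simp: exact_run_def nth_append)
    ultimately have "(x, ys, z) \<in> ?S" using w(1) v yz len by auto
    then show "w \<in> ?f ` ?S" using v yz by (intro image_eqI[of _ _ "(x, ys, z)"]) auto
  next
    fix w assume "w \<in> ?f ` ?S"
    then obtain x ys z where *: "w = x # ys @ [z]" "x < a" "set ys \<subseteq> {x..<a}" "length ys = k" "z < x"
      by auto
    have "x \<le> ys ! i" if "i < k" for i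
    proof -
      have "ys ! i \<in> set ys" using *(4) that by simp
      then have "ys ! i \<in> {x..<a}" using *(3) by blast
      then show ?thesis by simp
    qed
    then have "exact_run k w" using * by (auto simp: exact_run_def nth_append nth_Cons split: nat.split)
    then show "w \<in> {w \<in> words a (k + 2). exact_run k w}" using * by (auto simp: words_def)
  qed
  moreover have "inj_on ?f ?S" by (auto simp: inj_on_def)
  ultimately have "card {w \<in> words a (k + 2). exact_run k w} = card ?S" by (simp add: card_image)
  also have "\<dots> = (\<Sum>x<a. card (?M x \<times> {..<x}))"
    by (rule card_SigmaI) (auto intro!: finite_lists_length_eq)
  also have "\<dots> = (\<Sum>x<a. (a - x) ^ k * x)"
    by (simp add: card_cartesian_product card_lists_length_eq)
  finally show ?thesis .
qed

lemma run_prob_eq: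
  assumes "a > 0"
  shows "run_prob a k = real (card {w \<in> words a (k + 2). exact_run k w}) / real a ^ (k + 2)"
proof -
  have "real (\<Sum>x<a. (a - x) ^ k * x) = (\<Sum>x<a. real (a - x) ^ k * real x)" by simp
  also have "\<dots> = (\<Sum>s = 1..a. real s ^ k * (real a - real s))"
    by (rule sum.reindex_bij_witness[of _ "\<lambda>s. a - s" "\<lambda>x. a - x"]) (auto simp: of_nat_diff)
  also have "\<dots> = real a * (\<Sum>s = 1..a. real s ^ k) - (\<Sum>s = 1..a. real s ^ (k + 1))"
    by (simp add: sum_subtractf sum_distrib_left algebra_simps)
  finally show ?thesis
    using assms unfolding card_exact_run run_prob_def by (simp add: field_simps)
qed

lemma bool_pmf_eq_bernoulli: "q = bernoulli_pmf (pmf q True)"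
proof (rule pmf_eqI)
  fix b
  show "pmf q b = pmf (bernoulli_pmf (pmf q True)) b"
    by (cases b) (simp_all add: pmf_le_1 pmf_False_conv_True)
qed

lemma map_exact_run_pmf:
  assumes "a > 0"
  shows "map_pmf (exact_run k) (replicate_pmf (k + 2) (pmf_of_set {..<a})) = bernoulli_pmf (run_prob a k)"
    and "run_prob a k \<in> {0..1}"
proof -
  let ?q = "map_pmf (exact_run k) (replicate_pmf (k + 2) (pmf_of_set {..<a}))"
  have "pmf ?q True = measure (pmf_of_set (words a (k + 2))) {w. exact_run k w}"
    unfolding replicate_pmf_uniform[OF assms] by (simp add: pmf_map vimage_def)
  also have "\<dots> = run_prob a k"
    unfolding run_prob_eq[OF assms]
    by (subst measure_pmf_of_set[OF words_nonempty[OF assms] finite_words])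
       (simp add: card_words Collect_conj_eq)
  finally have *: "pmf ?q True = run_prob a k" .
  show "?q = bernoulli_pmf (run_prob a k)" using bool_pmf_eq_bernoulli[of ?q] unfolding * .
  show "run_prob a k \<in> {0..1}" using pmf_le_1[of ?q True] pmf_nonneg[of ?q True] unfolding * by simp
qed

text \<open>
  Prepending one window to a word shifts the numbering of its consecutive windows by one.
\<close>

lemma block_count_append:
  assumes "length xs = k + 2"
  shows "card {j. j < Suc J \<and> exact_run k (drop (j * (k + 2)) (xs @ ys))} =
         (if exact_run k xs then 1 else 0) + card {j. j < J \<and> exact_run k (drop (j * (k + 2)) ys)}"
proof -
  let ?A = "{j. j < J \<and> exact_run k (drop (j * (k + 2)) ys)}"
  have "{j. j < Suc J \<and> exact_run k (drop (j * (k + 2)) (xs @ ys))} =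
          (if exact_run k xs then {0} else {}) \<union> Suc ` ?A"
    (is "?L = ?R")
  proof (rule set_eqI)
    fix j show "j \<in> ?L \<longleftrightarrow> j \<in> ?R"
      using assms by (cases j) (auto simp: exact_run_append)
  qed
  moreover have "card ?R = card (if exact_run k xs then {0::nat} else {}) + card (Suc ` ?A)"
    by (rule card_Un_disjoint) auto
  ultimately show ?thesis by (simp add: card_image)
qed

text \<open>
  Consecutive disjoint windows of \<open>k + 2\<close> letters are independent, so the number of those that form a
  run is binomially distributed.
\<close>

lemma block_count_pmf:
  assumes a: "a > 0" and "J * (k + 2) \<le> N"
  shows "map_pmf (\<lambda>w. card {j. j < J \<and> exact_run k (drop (j * (k + 2)) w)})
           (replicate_pmf N (pmf_of_set {..<a})) = binomial_pmf J (run_prob a k)"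
  using assms(2)
proof (induction J arbitrary: N)
  case 0
  then show ?case using map_exact_run_pmf(2)[OF a, of k] by (simp add: binomial_pmf_0)
next
  case (Suc J)
  let ?U = "pmf_of_set {..<a}" and ?p = "run_prob a k"
  let ?c = "\<lambda>J w. card {j. j < J \<and> exact_run k (drop (j * (k + 2)) w)}"
  define N' where "N' = N - (k + 2)"
  have N: "N = (k + 2) + N'" "J * (k + 2) \<le> N'" using Suc.prems by (auto simp: N'_def)
  have "map_pmf (?c (Suc J)) (replicate_pmf N ?U) =
      bind_pmf (replicate_pmf (k + 2) ?U) (\<lambda>xs. bind_pmf (replicate_pmf N' ?U)
        (\<lambda>ys. return_pmf (?c (Suc J) (xs @ ys))))"
    unfolding N(1) replicate_pmf_distrib map_bind_pmf map_return_pmf ..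
  also have "\<dots> = bind_pmf (replicate_pmf (k + 2) ?U) (\<lambda>xs. bind_pmf (replicate_pmf N' ?U)
        (\<lambda>ys. return_pmf ((if exact_run k xs then 1 else 0) + ?c J ys)))"
    by (intro bind_pmf_cong refl, subst block_count_append)
       (auto simp: set_replicate_pmf simp del: replicate_pmf.simps)
  also have "\<dots> = bind_pmf (map_pmf (exact_run k) (replicate_pmf (k + 2) ?U))
      (\<lambda>b. bind_pmf (map_pmf (?c J) (replicate_pmf N' ?U))
        (\<lambda>c. return_pmf ((if b then 1 else 0) + c)))"
    unfolding bind_map_pmf ..
  also have "\<dots> = binomial_pmf (Suc J) ?p"
    unfolding map_exact_run_pmf(1)[OF a] Suc.IH[OF N(2)] binomial_pmf_Suc[OF map_exact_run_pmf(2)[OF a]] ..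
  finally show ?case .
qed

lemma residue_count_pmf:
  assumes a: "a > 0" and "r + J * (k + 2) \<le> N"
  shows "map_pmf (\<lambda>w. card {j. j < J \<and> exact_run k (drop (j * (k + 2) + r) w)})
           (replicate_pmf N (pmf_of_set {..<a})) = binomial_pmf J (run_prob a k)"
proof -
  let ?U = "pmf_of_set {..<a}"
  let ?c = "\<lambda>r w. card {j. j < J \<and> exact_run k (drop (j * (k + 2) + r) w)}"
  define N' where "N' = N - r"
  have N: "N = r + N'" "J * (k + 2) \<le> N'" using assms by (auto simp: N'_def)
  have "map_pmf (?c r) (replicate_pmf N ?U) =
      bind_pmf (replicate_pmf r ?U) (\<lambda>xs. bind_pmf (replicate_pmf N' ?U)
        (\<lambda>ys. return_pmf (?c r (xs @ ys))))"
    unfolding N(1) replicate_pmf_distrib map_bind_pmf map_return_pmf ..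
  also have "\<dots> = bind_pmf (replicate_pmf r ?U) (\<lambda>xs. bind_pmf (replicate_pmf N' ?U)
        (\<lambda>ys. return_pmf (?c 0 ys)))"
    by (intro bind_pmf_cong refl) (auto simp: set_replicate_pmf)
  also have "\<dots> = map_pmf (?c 0) (replicate_pmf N' ?U)"
    by (simp add: map_pmf_def)
  also have "\<dots> = binomial_pmf J (run_prob a k)"
    using block_count_pmf[OF a N(2)] by simp
  finally show ?thesis .
qed

lemma run_count_split:
  fixes J m :: nat
  shows "card {s. s < J * m \<and> P s} = (\<Sum>r<m. card {j. j < J \<and> P (j * m + r)})"
proof -
  have c: "card {x. x < n \<and> Q x} = (\<Sum>x<n. of_bool (Q x))" for n :: nat and Q
    by (simp add: of_bool_def sum.If_cases Int_def)
  have "card {s. s < J * m \<and> P s} = (\<Sum>j<J. sum (\<lambda>s. of_bool (P s)) {j * m..<j * m + m})"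
    unfolding c sum.nat_group ..
  also have "\<dots> = (\<Sum>j<J. \<Sum>r<m. of_bool (P (j * m + r)))"
  proof (rule sum.cong[OF refl])
    fix j
    show "sum (\<lambda>s. of_bool (P s)) {j * m..<j * m + m} = (\<Sum>r<m. of_bool (P (j * m + r)))"
      by (rule sum.reindex_bij_witness[of _ "\<lambda>r. j * m + r" "\<lambda>s. s - j * m"]) auto
  qed
  also have "\<dots> = (\<Sum>r<m. \<Sum>j<J. of_bool (P (j * m + r)))" by (rule sum.swap)
  finally show ?thesis unfolding c .
qed

lemma recursive_tree_pmf_eq:
  assumes "a > 0"
  shows "recursive_tree_pmf a n = map_pmf (\<lambda>w. tree_of n (shuffled a n w))
           (replicate_pmf (n - 1) (pmf_of_set {..<a}))"
  unfolding recursive_tree_pmf_def shuffle_pmf_eq[OF assms] replicate_pmf_uniform[OF assms]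
  by (simp add: pmf.map_comp o_def)

section \<open>Concentration and almost sure convergence\<close>

text \<open>
  The bound is geometric in \<open>n\<close>. The two lower bounds on \<open>n\<close> ensure that every residue class contains
  at least one window and that the \<open>O(k)\<close> boundary terms use up at most half of the deviation \<open>\<epsilon>\<close>.
\<close>

lemma tail_bound:
  fixes a k n :: nat and \<epsilon> :: real
  defines "m \<equiv> k + 2"
  assumes a: "a > 0" and \<epsilon>: "\<epsilon> > 0" and n: "n > 2 * m" "real n * \<epsilon> \<ge> 8 * real m"
  shows "measure_pmf.prob (recursive_tree_pmf a n)
           {T. \<bar>real (num_nodes_with_descendants k n T) / real n - run_prob a k\<bar> \<ge> \<epsilon>}
         \<le> 2 * real m * exp (\<epsilon>\<^sup>2) * exp (- (\<epsilon>\<^sup>2 / (2 * real m))) ^ n"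
proof -
  let ?p = "run_prob a k"
  let ?X = "num_nodes_with_descendants k n"
  let ?B = "{T. \<bar>real (?X T) / real n - ?p\<bar> \<ge> \<epsilon>}"
  define W where "W = replicate_pmf (n - 1) (pmf_of_set {..<a})"
  \<comment> \<open>One block is sacrificed so that all windows starting before \<open>J * m\<close> fit into the word.\<close>
  define J where "J = (n - 1) div m - 1"
  define c where "c r w = card {j. j < J \<and> exact_run k (drop (j * m + r) w)}" for r w
  have m: "m \<ge> 2" by (simp add: m_def)
  have p: "?p \<in> {0..1}" by (rule map_exact_run_pmf(2)[OF a])
  have "(n - 1) div m \<ge> 2" using n(1) m by (simp add: less_eq_div_iff_mult_less_eq)
  then have J: "J > 0" "(n - 1) div m = Suc J" by (simp_all add: J_def)
  then have nm: "n - 1 = Suc J * m + (n - 1) mod m" by (metis div_mult_mod_eq)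
  have "(n - 1) mod m < m" using m by simp
  then have le: "J * m + m \<le> n - 1" and ge: "n \<le> J * m + 2 * m" using nm n by simp_all
  have sW: "set_pmf W = words a (n - 1)"
    unfolding W_def replicate_pmf_uniform[OF a] by (simp add: words_nonempty finite_words a)
  have bad: "\<exists>r<m. \<bar>real (c r w) / real J - ?p\<bar> \<ge> \<epsilon> / 2"
    if w: "w \<in> words a (n - 1)" and B: "tree_of n (shuffled a n w) \<in> ?B" for w
  proof (rule ccontr)
    assume "\<not> ?thesis"
    then have small: "\<bar>real (c r w) - real J * ?p\<bar> \<le> real J * (\<epsilon> / 2)" if "r < m" for r
      using that J(1) by (force simp: abs_le_iff field_simps not_le)
    define X where "X = real (?X (tree_of n (shuffled a n w)))"
    define S where "S = real (\<Sum>r<m. c r w)"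
    have S: "S = real (card {s. s < J * m \<and> exact_run k (drop s w)})"
      unfolding S_def run_count_split c_def ..
    have "J * m + k + 1 \<le> n - 1" using le by (simp add: m_def)
    note bounds = num_nodes_bounds[OF _ w this]
    have XS: "S \<le> X" "X \<le> S + 2 * real m"
    proof -
      show "S \<le> X" unfolding S X_def using bounds(1) n by simp
      have "?X (tree_of n (shuffled a n w)) \<le> card {s. s < J * m \<and> exact_run k (drop s w)} + 2 * m"
        using bounds(2) n ge by linarith
      then have "X \<le> real (card {s. s < J * m \<and> exact_run k (drop s w)} + 2 * m)"
        unfolding X_def by (rule of_nat_mono)
      then show "X \<le> S + 2 * real m" unfolding S by simp
    qed
    \<comment> \<open>If all residue classes have small deviations, then so has their sum; cutting the deck down to
      \<open>J * m\<close> positions changes both the count and \<open>n * ?p\<close> by at most \<open>2 * m\<close>.\<close>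
    have "\<bar>S - real (J * m) * ?p\<bar> = \<bar>\<Sum>r<m. (real (c r w) - real J * ?p)\<bar>"
      by (simp add: S_def sum_subtractf algebra_simps)
    also have "\<dots> \<le> (\<Sum>r<m. \<bar>real (c r w) - real J * ?p\<bar>)" by (rule sum_abs)
    also have "\<dots> \<le> (\<Sum>r<m. real J * (\<epsilon> / 2))" by (intro sum_mono small) simp
    also have "\<dots> = real (J * m) * (\<epsilon> / 2)" by simp
    also have "\<dots> \<le> real n * (\<epsilon> / 2)" using \<epsilon> le by (intro mult_right_mono) (auto simp del: of_nat_mult)
    finally have 1: "\<bar>S - real (J * m) * ?p\<bar> \<le> real n * (\<epsilon> / 2)" .
    define d where "d = real n - real (J * m)"
    have d: "0 \<le> d" "d \<le> 2 * real m"
      using le ge unfolding d_def by linarith+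
    have "0 \<le> d * ?p" using d(1) p by simp
    moreover have "d * ?p \<le> d * 1" using d(1) p by (intro mult_left_mono) auto
    moreover have "d * ?p = real n * ?p - real (J * m) * ?p" unfolding d_def by (rule left_diff_distrib)
    ultimately have 2: "0 \<le> real n * ?p - real (J * m) * ?p" "real n * ?p - real (J * m) * ?p \<le> 2 * real m"
      using d(2) by linarith+
    have "\<bar>X - real n * ?p\<bar> \<le> real n * (\<epsilon> / 2) + 2 * real m"
      using XS 1 2 by linarith
    also have "\<dots> < real n * \<epsilon>" using n(2) m by (simp add: field_simps)
    finally have "\<bar>X - real n * ?p\<bar> < real n * \<epsilon>" .
    moreover have "real n > 0" using n by simp
    moreover have "X / real n - ?p = (X - real n * ?p) / real n" using \<open>real n > 0\<close> by (simp add: field_simps)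
    ultimately have "\<bar>X / real n - ?p\<bar> < \<epsilon>" by (simp add: field_simps)
    with B show False by (simp add: X_def)
  qed
  have "measure_pmf.prob (recursive_tree_pmf a n) ?B =
          measure_pmf.prob W {w. tree_of n (shuffled a n w) \<in> ?B}"
    by (simp add: recursive_tree_pmf_eq[OF a] W_def vimage_def)
  also have "\<dots> \<le> measure_pmf.prob W (\<Union>r<m. {w. \<bar>real (c r w) / real J - ?p\<bar> \<ge> \<epsilon> / 2})"
    by (rule measure_pmf.finite_measure_mono_AE) (use bad sW in \<open>auto simp: AE_measure_pmf_iff\<close>)
  also have "\<dots> \<le> (\<Sum>r<m. measure_pmf.prob W {w. \<bar>real (c r w) / real J - ?p\<bar> \<ge> \<epsilon> / 2})"
    by (rule measure_pmf.finite_measure_subadditive_finite) auto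
  also have "\<dots> \<le> (\<Sum>r<m. 2 * exp (- 2 * real J * (\<epsilon> / 2)\<^sup>2))"
  proof (rule sum_mono)
    fix r assume "r \<in> {..<m}"
    then have "r + J * m \<le> n - 1" using le by simp
    then have "map_pmf (c r) W = binomial_pmf J ?p"
      unfolding W_def c_def m_def by (rule residue_count_pmf[OF a])
    then have "measure_pmf.prob W {w. \<bar>real (c r w) / real J - ?p\<bar> \<ge> \<epsilon> / 2} =
        measure_pmf.prob (binomial_pmf J ?p) {x. \<bar>real x / real J - ?p\<bar> \<ge> \<epsilon> / 2}"
      by (simp add: vimage_def flip: \<open>map_pmf (c r) W = binomial_pmf J ?p\<close>)
    also have "\<dots> \<le> 2 * exp (- 2 * real J * (\<epsilon> / 2)\<^sup>2)"
      using binomial_distribution.prob_abs_ge'[of ?p J "\<epsilon> / 2"] p J \<epsilon>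
      by (simp add: binomial_distribution_def)
    finally show "measure_pmf.prob W {w. \<bar>real (c r w) / real J - ?p\<bar> \<ge> \<epsilon> / 2} \<le> \<dots>" .
  qed
  also have "\<dots> = 2 * real m * exp (- (real J * \<epsilon>\<^sup>2 / 2))" by (simp add: power_divide)
  also have "\<dots> \<le> 2 * real m * exp (\<epsilon>\<^sup>2 - real n * (\<epsilon>\<^sup>2 / (2 * real m)))"
  proof -
    have "real n \<le> real (J * m + 2 * m)" using ge by (rule of_nat_mono)
    then have "real n / real m \<le> real J + 2" using m by (simp add: field_simps)
    then have "real n / real m * (\<epsilon>\<^sup>2 / 2) \<le> (real J + 2) * (\<epsilon>\<^sup>2 / 2)"
      by (rule mult_right_mono) simp
    moreover have "real n / real m * (\<epsilon>\<^sup>2 / 2) = real n * (\<epsilon>\<^sup>2 / (2 * real m))" by simp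
    moreover have "(real J + 2) * (\<epsilon>\<^sup>2 / 2) = real J * \<epsilon>\<^sup>2 / 2 + \<epsilon>\<^sup>2" by (simp add: algebra_simps)
    ultimately have "- (real J * \<epsilon>\<^sup>2 / 2) \<le> \<epsilon>\<^sup>2 - real n * (\<epsilon>\<^sup>2 / (2 * real m))" by linarith
    then show ?thesis by (intro mult_left_mono) simp_all
  qed
  also have "\<dots> = 2 * real m * exp (\<epsilon>\<^sup>2) * exp (- (\<epsilon>\<^sup>2 / (2 * real m))) ^ n"
    by (simp add: exp_diff exp_of_nat_mult[symmetric] exp_minus field_simps)
  finally show ?thesis .
qed

theorem theorem4p4:
  fixes a k :: nat
    and M :: "'w measure"
    and T :: "nat \<Rightarrow> 'w \<Rightarrow> (nat \<times> nat) set"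
  assumes "a \<ge> 2"
    and "prob_space M"
    and "\<And>n. n \<ge> 2 \<Longrightarrow> T n \<in> measurable M (count_space UNIV)"
    and "\<And>n. n \<ge> 2 \<Longrightarrow> distr M (count_space UNIV) (T n) = measure_pmf (recursive_tree_pmf a n)"
  shows "AE \<omega> in M. (\<lambda>n. real (num_nodes_with_descendants k n (T n \<omega>)) / real n)
           \<longlonglongrightarrow> 1 / real a ^ (k + 1) * (\<Sum>s = 1..a. real s ^ k)
                - 1 / real a ^ (k + 2) * (\<Sum>s = 1..a. real s ^ (k + 1))"
proof -
  interpret prob_space M by fact
  have a: "a > 0" using assms(1) by simp
  let ?p = "run_prob a k" and ?m = "real (k + 2)"
  let ?Y = "\<lambda>n T. real (num_nodes_with_descendants k n T) / real n"
  have conv: "AE \<omega> in M. \<forall>\<^sub>F n in sequentially. \<bar>?Y n (T n \<omega>) - ?p\<bar> < \<epsilon>"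
    if \<epsilon>: "\<epsilon> > 0" for \<epsilon> :: real
  proof -
    define B where "B n = {T. \<bar>?Y n T - ?p\<bar> \<ge> \<epsilon>}" for n
    define A where "A n = (if n \<ge> 2 then T n -` B n \<inter> space M else {})" for n
    define q where "q = exp (- (\<epsilon>\<^sup>2 / (2 * ?m)))"
    have A_sets: "A n \<in> sets M" for n
      using measurable_sets[OF assms(3)[of n], of "B n"] by (auto simp: A_def)
    have meas: "measure M (A n) = measure_pmf.prob (recursive_tree_pmf a n) (B n)" if "n \<ge> 2" for n
      using that measure_distr[OF assms(3)[OF that], of "B n"] assms(4)[OF that] by (simp add: A_def)
    have "eventually (\<lambda>n. n > 2 * (k + 2)) sequentially" by (rule eventually_gt_at_top)
    moreover have "eventually (\<lambda>n. real n \<ge> 8 * ?m / \<epsilon>) sequentially"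
      using filterlim_real_sequentially unfolding filterlim_at_top by blast
    ultimately have "eventually (\<lambda>n. norm (measure M (A n)) \<le> 2 * ?m * exp (\<epsilon>\<^sup>2) * q ^ n) sequentially"
    proof eventually_elim
      case (elim n)
      then have "real n * \<epsilon> \<ge> 8 * ?m" using \<epsilon> by (simp add: field_simps)
      with elim have "measure_pmf.prob (recursive_tree_pmf a n) (B n) \<le> 2 * ?m * exp (\<epsilon>\<^sup>2) * q ^ n"
        unfolding B_def q_def by (intro tail_bound[OF a \<epsilon>])
      then show ?case using meas[of n] elim by simp
    qed
    moreover have "summable (\<lambda>n. 2 * ?m * exp (\<epsilon>\<^sup>2) * q ^ n)"
      using \<epsilon> by (intro summable_mult summable_geometric) (simp add: q_def)
    ultimately have "summable (\<lambda>n. measure M (A n))" by (rule summable_comparison_test_ev)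
    then have "AE \<omega> in M. \<forall>\<^sub>F n in sequentially. \<omega> \<in> space M - A n"
      by (intro borel_cantelli_AE1 A_sets) (auto simp: emeasure_eq_measure)
    then show ?thesis
    proof eventually_elim
      case (elim \<omega>)
      then have "\<forall>\<^sub>F n in sequentially. n \<ge> 2 \<and> \<omega> \<in> space M - A n"
        by (intro eventually_conj eventually_ge_at_top)
      then show ?case by eventually_elim (auto simp: A_def B_def)
    qed
  qed
  have "AE \<omega> in M. \<forall>i::nat. \<forall>\<^sub>F n in sequentially. \<bar>?Y n (T n \<omega>) - ?p\<bar> < 1 / real (Suc i)"
    unfolding AE_all_countable by (intro allI conv) simp
  then have "AE \<omega> in M. (\<lambda>n. ?Y n (T n \<omega>)) \<longlonglongrightarrow> ?p"
  proof eventually_elim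
    case (elim \<omega>)
    show ?case
    proof (rule tendstoI)
      fix e :: real assume "e > 0"
      then obtain i where i: "1 / real (Suc i) < e" using nat_approx_posE by blast
      from elim have "\<forall>\<^sub>F n in sequentially. \<bar>?Y n (T n \<omega>) - ?p\<bar> < 1 / real (Suc i)" by blast
      then show "\<forall>\<^sub>F n in sequentially. dist (?Y n (T n \<omega>)) ?p < e"
        by eventually_elim (use i in \<open>simp add: dist_real_def\<close>)
    qed
  qed
  then show ?thesis unfolding run_prob_def .
qed

end
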